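(* If $P$ is any Eulerian poset of rank $n+1\ge 1$, then $$F(P)=\sum_{w}\frac{1}{2^{|w|_{\mathbf d}+1}}\,[w]_P\,\Theta_w,$$ where the sum is over the $\mathbf{c}\mathbf{d}$-words $w$ of degree $n$ and the $[w]_P$ are the coefficients of the $\mathbf{c}\mathbf{d}$-index of $P$.
   Context: Posets are finite. A graded poset $P$ has unique minimal element $\widehat0$, unique maximal element $\widehat1$, and all maximal chains of the same length; $r(x)$ is the rank of $x$ and $r(P)=r(\widehat1)$. $P$ is Eulerian if it is graded and its M\"obius function satisfies $\mu(x,y)=(-1)^{r(y)-r(x)}$ for all $x\le y$. Put $[n]=\{1,\dots,n\}$, $[0]=\emptyset$. For $P$ of rank $n+1$ and $S\subset[n]$, $f_S(P)$ is the number of chains in $P$ whose elements have precisely the ranks in $S$; the flag $h$-vector is defined by $f_S=\sum_{T\subset S}h_T$. For a composition $\beta=(\beta_1,\dots,\beta_k)$, $M_\beta=\sum_{i_1<\cdots<i_k}x_{i_1}^{\beta_1}\cdots x_{i_k}^{\beta_k}$ (a quasisymmetric function over $\mathbb{Q}$). For $S=\{i_1<\dots<i_k\}\subset[n]$ let $M_S=M_S^{(n+1)}=M_{(i_1,i_2-i_1,\dots,i_k-i_{k-1},n+1-i_k)}$ (with $M_\emptyset^{(n+1)}=M_{(n+1)}$). The quasisymmetric function of $P$ is $F(P)=\sum_{S\subset[n]}f_S(P)\,M_S^{(n+1)}$. A $\mathbf{c}\mathbf{d}$-word is a (possibly empty) word in noncommuting letters $\mathbf{c},\mathbf{d}$ of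 degrees 1 and 2; $|w|_{\mathbf d}$ is the number of $\mathbf d$'s. For $w=\mathbf{c}^{n_1}\mathbf{d}\cdots\mathbf{c}^{n_k}\mathbf{d}\mathbf{c}^{m}$ of degree $n$, $S_w=\{n_1+2,\,n_1+n_2+4,\dots,n_1+\cdots+n_k+2k\}\subset[n]$, and $$\Theta_w=\sum_{T\subset[n]:\,S_w\subset T\cup(T+1)}2^{|T|+1}M_T^{(n+1)},\qquad T+1=\{i+1:i\in T\}.$$ The $\mathbf{c}\mathbf{d}$-index of an Eulerian poset $P$ of rank $n+1$ is the polynomial $\psi_P\in\mathbb{Z}\langle\mathbf c,\mathbf d\rangle$, homogeneous of degree $n$, that becomes $\sum_{S\subset[n]}h_S(P)\,u_S$ after substituting $\mathbf c=\mathbf a+\mathbf b$, $\mathbf d=\mathbf a\mathbf b+\mathbf b\mathbf a$ ($\mathbf a,\mathbf b$ noncommuting), where $u_S=u_1\cdots u_n$ with $u_i=\mathbf b$ if $i\in S$ and $u_i=\mathbf a$ otherwise. It exists and is unique; $[w]_P$ is the coefficient of $w$ in $\psi_P$. *)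

theory Defs
  imports Complex_Main "HOL-Library.Poly_Mapping"
begin

section \<open>Graded and Eulerian posets\<close>

text \<open>
  A poset is a reflexive partial order relation \<open>P\<close>, as in \<^theory>\<open>HOL.Order_Relation\<close>:
  its underlying set is \<^term>\<open>Field P\<close>, and \<open>(x, y) \<in> P\<close> means \<open>x \<le> y\<close>.
\<close>

definition minimal_in :: "'a rel \<Rightarrow> 'a \<Rightarrow> bool" where
  "minimal_in P x \<longleftrightarrow> x \<in> Field P \<and> (\<forall>y. (y, x) \<in> P \<longrightarrow> y = x)"

definition maximal_in :: "'a rel \<Rightarrow> 'a \<Rightarrow> bool" where
  "maximal_in P x \<longleftrightarrow> x \<in> Field P \<and> (\<forall>y. (x, y) \<in> P \<longrightarrow> y = x)"

definition maximal_chain :: "'a rel \<Rightarrow> 'a set \<Rightarrow> bool" where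
  "maximal_chain P C \<longleftrightarrow> C \<in> Chains P \<and> (\<forall>D\<in>Chains P. C \<subseteq> D \<longrightarrow> D = C)"

definition graded_poset :: "'a rel \<Rightarrow> bool" where
  "graded_poset P \<longleftrightarrow>
     finite (Field P) \<and> Partial_order P \<and>
     (\<exists>!x. minimal_in P x) \<and> (\<exists>!x. maximal_in P x) \<and>
     (\<forall>C D. maximal_chain P C \<longrightarrow> maximal_chain P D \<longrightarrow> card C = card D)"

definition top_elem :: "'a rel \<Rightarrow> 'a" where
  "top_elem P = (THE x. maximal_in P x)"

text \<open>
  The rank of \<open>x\<close> is the length of the interval from the least element to \<open>x\<close>, where a chain with
  \<open>k + 1\<close> elements has length \<open>k\<close>.
\<close>

definition rank :: "'a rel \<Rightarrow> 'a \<Rightarrow> nat" where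
  "rank P x = Max {card C - 1 | C. C \<in> Chains P \<and> C \<subseteq> under P x}"

definition poset_rank :: "'a rel \<Rightarrow> nat" where
  "poset_rank P = rank P (top_elem P)"

text \<open>
  The Moebius function. The test for a finite partial order only serves the termination of the
  recursion.
\<close>

function moebius :: "'a rel \<Rightarrow> 'a \<Rightarrow> 'a \<Rightarrow> int" where
  "moebius P x y =
     (if finite (Field P) \<and> Partial_order P \<and> (x, y) \<in> P then
        if x = y then 1
        else - (\<Sum>z \<in> {z. (x, z) \<in> P \<and> (z, y) \<in> P \<and> z \<noteq> y}. moebius P x z)
      else 0)"
  by auto
termination
proof (relation "measure (\<lambda>(P, x, y). card (under P y))")
  fix P :: "'a rel" and x y z
  assume a: "finite (Field P) \<and> Partial_order P \<and> (x, y) \<in> P"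
    and z: "z \<in> {z. (x, z) \<in> P \<and> (z, y) \<in> P \<and> z \<noteq> y}"
  have tr: "trans P" and an: "antisym P" and re: "refl_on (Field P) P"
    using a by (auto simp: order_on_defs)
  have "under P z \<subseteq> under P y"
    using z tr by (auto simp: under_def dest: transD)
  moreover have "y \<in> under P y"
    using re a by (auto simp: under_def refl_on_def Field_def)
  moreover have "y \<notin> under P z"
    using an z by (auto simp: under_def dest: antisymD)
  ultimately have "under P z \<subset> under P y" by blast
  moreover have "finite (under P y)"
  proof (rule finite_subset)
    show "under P y \<subseteq> Field P" by (auto simp: under_def Field_def)
    show "finite (Field P)" using a by blast
  qed
  ultimately show "((P, x, z), P, x, y) \<in> measure (\<lambda>(P, x, y). card (under P y))"
    by (simp add: psubset_card_mono)
qed simp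

declare moebius.simps [simp del]

definition eulerian :: "'a rel \<Rightarrow> bool" where
  "eulerian P \<longleftrightarrow> graded_poset P \<and>
     (\<forall>x y. (x, y) \<in> P \<longrightarrow> moebius P x y = (- 1) ^ (rank P y - rank P x))"


section \<open>Flag vectors\<close>

definition flag_f :: "'a rel \<Rightarrow> nat set \<Rightarrow> nat" where
  "flag_f P S = card {C. C \<in> Chains P \<and> rank P ` C = S}"

text \<open>The recursion is \<open>f\<^sub>S = (\<Sum>T\<subseteq>S. h\<^sub>T)\<close>, solved for \<open>h\<^sub>S\<close>.\<close>

function flag_h :: "'a rel \<Rightarrow> nat set \<Rightarrow> int" where
  "flag_h P S =
     (if finite S then int (flag_f P S) - (\<Sum>T \<in> {T. T \<subset> S}. flag_h P T) else 0)"
  by auto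
termination
  by (relation "measure (\<lambda>(P, S). card S)") (auto intro: psubset_card_mono)

declare flag_h.simps [simp del]

lemma flag_f_eq_sum_flag_h:
  assumes "finite S"
  shows "int (flag_f P S) = (\<Sum>T \<in> Pow S. flag_h P T)"
proof -
  have "Pow S = insert S {T. T \<subset> S}" by auto
  moreover have "finite {T. T \<subset> S}"
    using assms by (auto intro: finite_subset[of _ "Pow S"])
  ultimately have "(\<Sum>T \<in> Pow S. flag_h P T) = flag_h P S + (\<Sum>T \<in> {T. T \<subset> S}. flag_h P T)"
    by simp
  then show ?thesis
    using assms by (simp add: flag_h.simps[of P S])
qed


section \<open>Noncommutative polynomials and the cd-index\<close>

text \<open>
  Lists form the free monoid under concatenation, so that the type \<^typ>\<open>'x list \<Rightarrow>\<^sub>0 int\<close> with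
  the convolution product is the ring of integer polynomials in noncommuting letters \<^typ>\<open>'x\<close>.
\<close>

instantiation list :: (type) monoid_add
begin

definition zero_list :: "'a list" where "zero_list = []"

definition plus_list :: "'a list \<Rightarrow> 'a list \<Rightarrow> 'a list" where "plus_list = (@)"

instance
  by standard (simp_all add: zero_list_def plus_list_def)

end

datatype ab = LA | LB
datatype cd = LC | LD

definition letter :: "'x \<Rightarrow> 'x list \<Rightarrow>\<^sub>0 int" where
  "letter x = Poly_Mapping.single [x] 1"

fun letter_degree :: "cd \<Rightarrow> nat" where
  "letter_degree LC = 1"
| "letter_degree LD = 2"

definition cd_degree :: "cd list \<Rightarrow> nat" where
  "cd_degree w = sum_list (map letter_degree w)"

lemma finite_cd_degree: "finite {w. cd_degree w = n}"
proof (rule finite_subset)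
  have len: "length w \<le> cd_degree w" for w
  proof (induction w)
    case (Cons x w)
    then show ?case by (cases x) (simp_all add: cd_degree_def)
  qed (simp add: cd_degree_def)
  have letters: "set w \<subseteq> {LC, LD}" for w
  proof
    fix x show "x \<in> {LC, LD}" by (cases x) simp_all
  qed
  show "{w. cd_degree w = n} \<subseteq> {w. set w \<subseteq> {LC, LD} \<and> length w \<le> n}"
  proof
    fix w assume "w \<in> {w. cd_degree w = n}"
    with len[of w] letters[of w] show "w \<in> {w. set w \<subseteq> {LC, LD} \<and> length w \<le> n}"
      by simp
  qed
  show "finite {w. set w \<subseteq> {LC, LD} \<and> length w \<le> n}"
    by (rule finite_lists_length_le) simp
qed

fun cd_to_ab :: "cd \<Rightarrow> ab list \<Rightarrow>\<^sub>0 int" where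
  "cd_to_ab LC = letter LA + letter LB"
| "cd_to_ab LD = letter LA * letter LB + letter LB * letter LA"

definition cd_subst :: "(cd list \<Rightarrow>\<^sub>0 int) \<Rightarrow> (ab list \<Rightarrow>\<^sub>0 int)" where
  "cd_subst \<psi> =
     (\<Sum>w \<in> Poly_Mapping.keys \<psi>. of_int (Poly_Mapping.lookup \<psi> w) * prod_list (map cd_to_ab w))"

definition u_monomial :: "nat \<Rightarrow> nat set \<Rightarrow> ab list \<Rightarrow>\<^sub>0 int" where
  "u_monomial n S = prod_list (map (\<lambda>i. if i \<in> S then letter LB else letter LA) [1..<Suc n])"

definition is_cd_index :: "'a rel \<Rightarrow> (cd list \<Rightarrow>\<^sub>0 int) \<Rightarrow> bool" where
  "is_cd_index P \<psi> \<longleftrightarrow>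
     (let n = poset_rank P - 1 in
        (\<forall>w \<in> Poly_Mapping.keys \<psi>. cd_degree w = n) \<and>
        cd_subst \<psi> = (\<Sum>S \<in> Pow {1..n}. of_int (flag_h P S) * u_monomial n S))"

definition cd_index :: "'a rel \<Rightarrow> (cd list \<Rightarrow>\<^sub>0 int)" where
  "cd_index P = (THE \<psi>. is_cd_index P \<psi>)"


section \<open>Quasisymmetric functions\<close>

text \<open>
  A formal power series over the rationals in infinitely many commuting variables is given by its
  coefficients: the monomial in which the \<open>i\<close>-th variable has exponent \<open>Poly_Mapping.lookup m i\<close> is \<open>m\<close>.
  The
  variables are indexed from \<open>0\<close>.
\<close>

type_synonym power_series = "(nat \<Rightarrow>\<^sub>0 nat) \<Rightarrow> rat"

text \<open>
  The coefficient of \<open>m\<close> in the infinite sum over \<open>i\<^sub>1 < \<dots> < i\<^sub>k\<close> is the number of index lists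
  whose term is the monomial \<open>m\<close>.
\<close>

definition M_comp :: "nat list \<Rightarrow> power_series" where
  "M_comp \<beta> m = of_nat (card {is. length is = length \<beta> \<and> sorted_wrt (<) is \<and>
     (\<Sum>(i, b) \<leftarrow> zip is \<beta>. Poly_Mapping.single i b) = m})"

text \<open>
  The composition \<open>(i\<^sub>1, i\<^sub>2 - i\<^sub>1, \<dots>, i\<^sub>k - i\<^sub>k\<^sub>-\<^sub>1, N - i\<^sub>k)\<close> of \<open>N\<close> for
  \<open>S = {i\<^sub>1 < \<dots> < i\<^sub>k}\<close>.
\<close>

definition comp_of_set :: "nat \<Rightarrow> nat set \<Rightarrow> nat list" where
  "comp_of_set N S = map2 (-) (sorted_list_of_set S @ [N]) (0 # sorted_list_of_set S)"

definition M_set :: "nat \<Rightarrow> nat set \<Rightarrow> power_series" where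
  "M_set N S = M_comp (comp_of_set N S)"

definition F_quasi :: "'a rel \<Rightarrow> power_series" where
  "F_quasi P = (\<lambda>m. \<Sum>S \<in> Pow {1..poset_rank P - 1}.
     of_nat (flag_f P S) * M_set (poset_rank P) S m)"

text \<open>\<open>n\<^sub>1 + \<dots> + n\<^sub>j + 2j\<close> is the degree of the prefix of \<open>w\<close> that ends with the \<open>j\<close>-th \<open>LD\<close>.\<close>

definition S_word :: "cd list \<Rightarrow> nat set" where
  "S_word w = {cd_degree (u @ [LD]) | u v. w = u @ [LD] @ v}"

definition Theta :: "cd list \<Rightarrow> power_series" where
  "Theta w = (\<lambda>m. let n = cd_degree w in
     \<Sum>T \<in> {T. T \<subseteq> {1..n} \<and> S_word w \<subseteq> T \<union> Suc ` T}. 2 ^ (card T + 1) * M_set (n + 1) T m)"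

end

theory Submission
  imports Defs
begin

text \<open>
  Both sides are combinations of the \<open>M_set (n + 1) T\<close>, and comparing coefficients leaves an identity for
  each flag number: \<open>f\<^sub>T\<close> is the sum of \<open>[w] 2\<^bsup>|T| - |w|\<^esup>\<close> over the words \<open>w\<close> of degree \<open>n\<close> with
  \<open>S_word w \<subseteq> T \<union> (T + 1)\<close>, where \<open>|w|\<close> is the number of letters \<open>\<^bold>d\<close> (\<open>flag_f_eq_sum_cd_index\<close>). Since
  \<open>f\<^sub>T = (\<Sum>S\<subseteq>T. h\<^sub>S)\<close> and \<open>h\<^sub>S\<close> is the coefficient of the \<open>\<^bold>c\<^bold>d\<close>-index at the word \<open>u\<^sub>S\<close>, this amounts to
  counting the sets \<open>S \<subseteq> T\<close> whose word occurs when \<open>w\<close> is multiplied out, which is done letter by letter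
  in \<open>sum_coeff_cd_monomial\<close>.

  That argument presupposes that the \<open>\<^bold>c\<^bold>d\<close>-index exists and is unique. Uniqueness is the linear
  independence of the \<open>\<^bold>c\<^bold>d\<close>-monomials (\<open>cd_combination_dvd\<close>). Existence follows Stanley's argument.
  The \<open>\<^bold>a\<^bold>b\<close>-index is a sum over chains, in which a rank has weight \<open>\<^bold>b\<close> if it is met and \<open>\<^bold>a - \<^bold>b\<close> if
  not. Splitting a chain at its least element gives a recursion over the upper intervals
  (\<open>ab_index_tail_b\<close>). The Euler relation shows that the recursion stays valid when \<open>\<^bold>a\<close> and \<open>\<^bold>b\<close> are
  exchanged (\<open>ab_index_tail_a\<close>). In the sum of the two only \<open>\<^bold>a + \<^bold>b = \<^bold>c\<close> and even powers of
  \<open>\<^bold>a - \<^bold>b\<close> are left, and \<open>(\<^bold>a - \<^bold>b)\<^sup>2 = \<^bold>c\<^sup>2 - 2 \<^bold>d\<close>. So by induction twice the \<open>\<^bold>a\<^bold>b\<close>-index is an integral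
  \<open>\<^bold>c\<^bold>d\<close>-polynomial (\<open>ab_index_cd\<close>); independence modulo \<open>2\<close> then shows that its coefficients are
  even.
\<close>


section \<open>Noncommutative polynomials in c and d\<close>

abbreviation coeff :: "('x list \<Rightarrow>\<^sub>0 int) \<Rightarrow> 'x list \<Rightarrow> int" where
  "coeff \<equiv> Poly_Mapping.lookup"

lemma coeff_of_int_mult: "coeff (of_int k * p) v = k * coeff p v"
  by (induction k rule: int_induct[of _ 0]) (simp_all add: algebra_simps lookup_add lookup_minus)

lemma coeff_letter_mult_Sum_any:
  "coeff (letter x * p) u = (\<Sum>q. coeff p q when u = x # q)"
proof -
  have "coeff (letter x * p) u = (\<Sum>l. (\<Sum>q. coeff p q when u = l @ q) when l = [x])"
    unfolding letter_def lookup_mult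
    by (rule Sum_any.cong) (auto simp: lookup_single plus_list_def when_def)
  then show ?thesis by simp
qed

lemma coeff_letter_mult_Cons: "coeff (letter x * p) (y # v) = (if x = y then coeff p v else 0)"
proof -
  have "(\<Sum>q. coeff p q when v = q) = (\<Sum>q. coeff p q when q = v)"
    by (rule Sum_any.cong) (auto simp: when_def)
  then show ?thesis
    by (auto simp: coeff_letter_mult_Sum_any)
qed

lemma coeff_letter_mult_Nil: "coeff (letter x * p) [] = 0"
  by (simp add: coeff_letter_mult_Sum_any)

lemmas coeff_letter_mult = coeff_letter_mult_Cons coeff_letter_mult_Nil

abbreviation cd_monomial :: "cd list \<Rightarrow> (ab list \<Rightarrow>\<^sub>0 int)" where
  "cd_monomial w \<equiv> prod_list (map cd_to_ab w)"

text \<open>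
  The coefficients \<open>\<phi>\<close> of a homogeneous \<open>\<^bold>c\<^bold>d\<close>-polynomial are kept apart from its expansion in \<open>\<^bold>a\<close>
  and \<open>\<^bold>b\<close>, because statements about \<open>\<phi>\<close> have to be derived from statements about the expansion.
\<close>

definition cd_combination :: "nat \<Rightarrow> (cd list \<Rightarrow> int) \<Rightarrow> (ab list \<Rightarrow>\<^sub>0 int)" where
  "cd_combination n \<phi> = (\<Sum>w | cd_degree w = n. of_int (\<phi> w) * cd_monomial w)"

lemma cd_degree_simps [simp]:
  "cd_degree [] = 0" "cd_degree (LC # w) = Suc (cd_degree w)"
  "cd_degree (LD # w) = Suc (Suc (cd_degree w))"
  "cd_degree (u @ v) = cd_degree u + cd_degree v"
  by (simp_all add: cd_degree_def)

lemma cd_words_0: "{w. cd_degree w = 0} = {[]}"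
proof -
  have "w = []" if "cd_degree w = 0" for w
    using that by (cases w rule: list.exhaust; cases "hd w") auto
  then show ?thesis by auto
qed

lemma cd_words_1: "{w. cd_degree w = Suc 0} = {[LC]}"
proof -
  have "w = [LC]" if "cd_degree w = Suc 0" for w
    using that cd_words_0 by (cases w rule: list.exhaust; cases "hd w") auto
  then show ?thesis by auto
qed

lemma cd_words_Suc_Suc:
  "{w. cd_degree w = Suc (Suc n)} = (#) LC ` {w. cd_degree w = Suc n} \<union> (#) LD ` {w. cd_degree w = n}"
proof -
  have "w \<in> (#) LC ` {w. cd_degree w = Suc n} \<union> (#) LD ` {w. cd_degree w = n}"
    if "cd_degree w = Suc (Suc n)" for w
    using that by (cases w rule: list.exhaust; cases "hd w") auto
  then show ?thesis by auto
qed

lemma cd_combination_0: "cd_combination 0 \<phi> = of_int (\<phi> [])"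
  by (simp add: cd_combination_def cd_words_0)

lemma cd_combination_1: "cd_combination (Suc 0) \<phi> = of_int (\<phi> [LC]) * cd_to_ab LC"
  by (simp add: cd_combination_def cd_words_1)

lemma cd_combination_Suc_Suc:
  "cd_combination (Suc (Suc n)) \<phi> =
     cd_to_ab LC * cd_combination (Suc n) (\<lambda>w. \<phi> (LC # w)) +
     cd_to_ab LD * cd_combination n (\<lambda>w. \<phi> (LD # w))"
proof -
  have pull: "x * (of_int k * y) = of_int k * (x * y)" for x y :: "ab list \<Rightarrow>\<^sub>0 int" and k
    by (metis mult.assoc mult_of_int_commute)
  show ?thesis
    unfolding cd_combination_def cd_words_Suc_Suc
    by (subst sum.union_disjoint)
      (auto simp: finite_cd_degree sum.reindex sum_distrib_left pull o_def simp del: cd_to_ab.simps)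
qed

text \<open>
  Comparing the coefficients at words that begin with \<open>aa\<close>, \<open>bb\<close> and \<open>ab\<close> separates the two
  parts of \<open>\<^bold>c x + \<^bold>d y\<close>: the first two see only \<open>x\<close>, and the third sees the sum of a coefficient
  of \<open>x\<close> and one of \<open>y\<close>. The modulus is kept general because two cases matter: \<open>m = 0\<close> is the linear
  independence of the \<open>\<^bold>c\<^bold>d\<close>-monomials, and \<open>m = 2\<close> lets a factor \<open>2\<close> be cancelled without
  leaving the integers.
\<close>

lemma cd_combination_dvd:
  assumes "\<And>v. m dvd coeff (cd_combination n \<phi>) v" and "cd_degree w = n"
  shows "m dvd \<phi> w"
  using assms
proof (induction n arbitrary: \<phi> w rule: less_induct)
  case (less n)
  consider "n = 0" | "n = Suc 0" | k where "n = Suc (Suc k)"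
    by (metis not0_implies_Suc)
  then show ?case
  proof cases
    case 1
    then have "w = []" using less.prems cd_words_0 by auto
    with less.prems(1)[of "[]"] 1 show ?thesis
      by (simp add: cd_combination_0 lookup_of_int zero_list_def)
  next
    case 2
    then have "w = [LC]" using less.prems cd_words_1 by auto
    with less.prems(1)[of "[LA]"] 2 show ?thesis
      by (simp add: cd_combination_1 letter_def coeff_of_int_mult lookup_add lookup_single)
  next
    case 3
    define x where "x = cd_combination (Suc k) (\<lambda>w. \<phi> (LC # w))"
    define y where "y = cd_combination k (\<lambda>w. \<phi> (LD # w))"
    have eq: "cd_combination n \<phi> =
        letter LA * x + letter LB * x + letter LA * (letter LB * y) + letter LB * (letter LA * y)"
      by (simp add: 3 cd_combination_Suc_Suc x_def y_def algebra_simps)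
    note c = eq lookup_add coeff_letter_mult
    have x: "m dvd coeff x v" for v
    proof (cases v)
      case Nil
      then show ?thesis using less.prems(1)[of "[LA]"] by (simp add: c)
    next
      case (Cons z v')
      then show ?thesis using less.prems(1)[of "z # v"] by (cases z) (simp_all add: c)
    qed
    have "m dvd coeff x (LB # v) + coeff y v" for v
      using less.prems(1)[of "LA # LB # v"] by (simp add: c)
    then have y: "m dvd coeff y v" for v
      using x dvd_add_right_iff by blast
    from less.prems(2) 3 consider u where "w = LC # u" "cd_degree u = Suc k"
      | u where "w = LD # u" "cd_degree u = k"
      using cd_words_Suc_Suc by blast
    then show ?thesis
    proof cases
      case (1 u)
      then show ?thesis using less.IH[of "Suc k" "\<lambda>w. \<phi> (LC # w)" u] x 3 by (simp add: x_def)
    next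
      case (2 u)
      then show ?thesis using less.IH[of k "\<lambda>w. \<phi> (LD # w)" u] y 3 by (simp add: y_def)
    qed
  qed
qed

definition cd_polynomials :: "nat \<Rightarrow> (ab list \<Rightarrow>\<^sub>0 int) set" where
  "cd_polynomials n = range (cd_combination n)"

lemma of_int_cd_polynomials: "of_int k \<in> cd_polynomials 0"
  unfolding cd_polynomials_def
  by (rule range_eqI[of _ _ "\<lambda>_. k"]) (simp add: cd_combination_0)

lemma cd_polynomials_add: "p \<in> cd_polynomials n \<Longrightarrow> q \<in> cd_polynomials n \<Longrightarrow> p + q \<in> cd_polynomials n"
proof -
  have "cd_combination n \<phi> + cd_combination n \<chi> = cd_combination n (\<lambda>w. \<phi> w + \<chi> w)" for \<phi> \<chi>
    by (simp add: cd_combination_def sum.distrib algebra_simps)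
  then show "p \<in> cd_polynomials n \<Longrightarrow> q \<in> cd_polynomials n \<Longrightarrow> p + q \<in> cd_polynomials n"
    by (auto simp: cd_polynomials_def)
qed

lemma cd_polynomials_of_int_mult: "p \<in> cd_polynomials n \<Longrightarrow> of_int k * p \<in> cd_polynomials n"
proof -
  have "of_int k * cd_combination n \<phi> = cd_combination n (\<lambda>w. k * \<phi> w)" for \<phi>
    by (simp add: cd_combination_def sum_distrib_left algebra_simps)
  then show "p \<in> cd_polynomials n \<Longrightarrow> of_int k * p \<in> cd_polynomials n"
    by (auto simp: cd_polynomials_def)
qed

lemma cd_polynomials_0: "0 \<in> cd_polynomials n"
proof -
  have "cd_combination n (\<lambda>_. 0) = 0" by (simp add: cd_combination_def)
  then show ?thesis by (auto simp: cd_polynomials_def intro!: range_eqI[of _ _ "\<lambda>_. 0"])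
qed

lemma cd_polynomials_uminus: "p \<in> cd_polynomials n \<Longrightarrow> - p \<in> cd_polynomials n"
  using cd_polynomials_of_int_mult[of p n "-1"] by simp

lemma cd_polynomials_sum:
  "(\<And>i. i \<in> I \<Longrightarrow> f i \<in> cd_polynomials n) \<Longrightarrow> (\<Sum>i\<in>I. f i) \<in> cd_polynomials n"
  by (induction I rule: infinite_finite_induct) (auto intro: cd_polynomials_0 cd_polynomials_add)

lemma cd_polynomials_c_mult:
  assumes "p \<in> cd_polynomials n" shows "cd_to_ab LC * p \<in> cd_polynomials (Suc n)"
proof -
  from assms obtain \<phi> where p: "p = cd_combination n \<phi>" by (auto simp: cd_polynomials_def)
  let ?\<chi> = "\<lambda>w. case w of LC # u \<Rightarrow> \<phi> u | _ \<Rightarrow> 0"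
  have "cd_to_ab LC * p = cd_combination (Suc n) ?\<chi>"
  proof (cases n)
    case 0
    then show ?thesis
      by (simp add: p cd_combination_0 cd_combination_1 mult_of_int_commute del: cd_to_ab.simps)
  next
    case (Suc k)
    then show ?thesis
      using cd_combination_def[of k "\<lambda>_. 0"]
      by (simp add: p cd_combination_Suc_Suc del: cd_to_ab.simps)
  qed
  then show ?thesis by (auto simp: cd_polynomials_def)
qed

lemma cd_polynomials_d_mult:
  assumes "p \<in> cd_polynomials n" shows "cd_to_ab LD * p \<in> cd_polynomials (Suc (Suc n))"
proof -
  from assms obtain \<phi> where p: "p = cd_combination n \<phi>" by (auto simp: cd_polynomials_def)
  let ?\<chi> = "\<lambda>w. case w of LD # u \<Rightarrow> \<phi> u | _ \<Rightarrow> 0"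
  have "cd_to_ab LD * p = cd_combination (Suc (Suc n)) ?\<chi>"
    using cd_combination_def[of "Suc n" "\<lambda>_. 0"]
    by (simp add: p cd_combination_Suc_Suc del: cd_to_ab.simps)
  then show ?thesis by (auto simp: cd_polynomials_def)
qed

text \<open>
  This difference is the weight of a rank that a chain omits. It is not a \<open>\<^bold>c\<^bold>d\<close>-polynomial, but
  its square \<open>\<^bold>c\<^sup>2 - 2 \<^bold>d\<close> is.
\<close>

definition a_minus_b :: "ab list \<Rightarrow>\<^sub>0 int" where
  "a_minus_b = letter LA - letter LB"

lemma a_minus_b_squared: "a_minus_b * a_minus_b = cd_to_ab LC * cd_to_ab LC - 2 * cd_to_ab LD"
  by (simp add: a_minus_b_def algebra_simps mult_2)

lemma cd_polynomials_even_power_mult: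
  "p \<in> cd_polynomials n \<Longrightarrow> a_minus_b ^ (2 * k) * p \<in> cd_polynomials (n + 2 * k)"
proof (induction k)
  case (Suc k)
  let ?q = "a_minus_b ^ (2 * k) * p"
  have "a_minus_b ^ (2 * Suc k) * p = a_minus_b * a_minus_b * ?q"
    by (simp add: mult.assoc)
  also have "\<dots> = cd_to_ab LC * (cd_to_ab LC * ?q) + of_int (-2) * (cd_to_ab LD * ?q)"
    unfolding a_minus_b_squared by (simp add: mult.assoc left_diff_distrib del: cd_to_ab.simps)
  also have "\<dots> \<in> cd_polynomials (Suc (Suc (n + 2 * k)))"
    using Suc by (intro cd_polynomials_add cd_polynomials_of_int_mult cd_polynomials_c_mult
        cd_polynomials_d_mult)
  finally show ?case by simp
qed simp

text \<open>
  Without this step the induction in \<open>ab_index_cd\<close>, which gives a formula for twice the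
  \<open>\<^bold>a\<^bold>b\<close>-index, would only yield rational coefficients. They are integral because the expansion is, by
  \<open>cd_combination_dvd\<close> with modulus \<open>2\<close>.
\<close>

lemma cd_polynomials_half:
  assumes "p + p \<in> cd_polynomials n" shows "p \<in> cd_polynomials n"
proof -
  from assms obtain \<phi> where p: "p + p = cd_combination n \<phi>" by (auto simp: cd_polynomials_def)
  have "2 dvd coeff (cd_combination n \<phi>) v" for v
    unfolding p[symmetric] by (simp add: lookup_add)
  then have even: "2 dvd \<phi> w" if "cd_degree w = n" for w
    using cd_combination_dvd that by blast
  have "cd_combination n \<phi> = cd_combination n (\<lambda>w. \<phi> w div 2) + cd_combination n (\<lambda>w. \<phi> w div 2)"
    unfolding cd_combination_def sum.distrib[symmetric] distrib_right[symmetric] of_int_add[symmetric]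
    using even by (intro sum.cong) (auto elim: dvdE)
  then have eq: "p + p = cd_combination n (\<lambda>w. \<phi> w div 2) + cd_combination n (\<lambda>w. \<phi> w div 2)"
    using p by simp
  have "p = cd_combination n (\<lambda>w. \<phi> w div 2)"
  proof (rule poly_mapping_eqI)
    fix v
    show "coeff p v = coeff (cd_combination n (\<lambda>w. \<phi> w div 2)) v"
      using arg_cong[OF eq, of "\<lambda>q. coeff q v"] by (simp add: lookup_add)
  qed
  then show ?thesis by (auto simp: cd_polynomials_def)
qed


section \<open>Chains weighted by noncommutative monomials\<close>

text \<open>
  Substituting \<open>f\<^sub>T = (\<Sum>S\<subseteq>T. h\<^sub>S)\<close> turns the generating function of the \<open>h\<^sub>S\<close> into one of chains: a
  rank met by the chain contributes \<open>\<^bold>b\<close>, a rank missed by it contributes \<open>\<^bold>a - \<^bold>b\<close>.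
\<close>

definition chain_weight :: "nat \<Rightarrow> nat \<Rightarrow> nat set \<Rightarrow> (ab list \<Rightarrow>\<^sub>0 int)" where
  "chain_weight l m T = prod_list (map (\<lambda>i. if i \<in> T then letter LB else a_minus_b) [l..<m])"

lemma chain_weight_empty: "chain_weight l m {} = a_minus_b ^ (m - l)"
  by (simp add: chain_weight_def map_replicate_const)

lemma chain_weight_split:
  assumes "l \<le> j" "j < m" "\<And>i. i \<in> T \<Longrightarrow> j < i"
  shows "chain_weight l m (insert j T) = a_minus_b ^ (j - l) * (letter LB * chain_weight (Suc j) m T)"
proof -
  let ?f = "\<lambda>i. if i \<in> insert j T then letter LB else a_minus_b"
  have split: "[l..<m] = [l..<j] @ j # [Suc j..<m]"
    using assms(1,2) by (metis le_add_diff_inverse less_or_eq_imp_le upt_add_eq_append upt_conv_Cons)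
  have "map ?f [l..<j] = map (\<lambda>_. a_minus_b) [l..<j]"
    by (auto dest!: assms(3))
  then have before: "prod_list (map ?f [l..<j]) = a_minus_b ^ (j - l)"
    by (simp only: map_replicate_const prod_list_replicate length_upt)
  have after: "map ?f [Suc j..<m] = map (\<lambda>i. if i \<in> T then letter LB else a_minus_b) [Suc j..<m]"
    by auto
  have "chain_weight l m (insert j T) = prod_list (map ?f [l..<j]) * (?f j * prod_list (map ?f [Suc j..<m]))"
    unfolding chain_weight_def split by simp
  then show ?thesis
    unfolding before after chain_weight_def by simp
qed

section \<open>Eulerian posets and their ab-indices\<close>

locale eulerian_poset =
  fixes P :: "'a rel"
  assumes eulerian: "eulerian P"
begin

lemma finite_Field: "finite (Field P)" and partial_order: "Partial_order P"
  using eulerian by (auto simp: eulerian_def graded_poset_def)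

lemma refl: "x \<in> Field P \<Longrightarrow> (x, x) \<in> P"
  and trans: "(x, y) \<in> P \<Longrightarrow> (y, z) \<in> P \<Longrightarrow> (x, z) \<in> P"
  and antisym: "(x, y) \<in> P \<Longrightarrow> (y, x) \<in> P \<Longrightarrow> x = y"
  using partial_order unfolding order_on_defs
  by (blast dest: refl_onD transD antisymD)+

lemma Field1: "(x, y) \<in> P \<Longrightarrow> x \<in> Field P" and Field2: "(x, y) \<in> P \<Longrightarrow> y \<in> Field P"
  by (auto simp: Field_def)

lemma Chains_subset_Field: "C \<in> Chains P \<Longrightarrow> C \<subseteq> Field P"
  by (auto simp: Chains_def Field_def)

lemma finite_Chains: "finite (Chains P)"
  by (rule finite_subset[of _ "Pow (Field P)"]) (auto simp: finite_Field dest: Chains_subset_Field)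

lemma finite_chain: "C \<in> Chains P \<Longrightarrow> finite C"
  by (rule finite_subset[OF Chains_subset_Field finite_Field])

lemma finite_above: "finite {y. (x, y) \<in> P}" and finite_below: "finite {y. (y, x) \<in> P}"
  by (rule finite_subset[OF _ finite_Field]; auto simp: Field_def)+

text \<open>
  A longest chain below \<open>x\<close> can be extended by \<open>y\<close>. The case distinction on the empty chain is forced
  by the truncated \<open>card C - 1\<close>, which gives the empty chain and the one-element chains the same
  length.
\<close>

lemma rank_strict_mono:
  assumes xy: "(x, y) \<in> P" "x \<noteq> y"
  shows "rank P x < rank P y"
proof -
  let ?R = "\<lambda>x. {card C - 1 | C. C \<in> Chains P \<and> C \<subseteq> under P x}"
  have fin: "finite (?R x)" for x
    using finite_Chains by simp
  have "card {} - 1 \<in> ?R x"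
    unfolding mem_Collect_eq by (rule exI[of _ "{}"]) (simp add: Chains_def)
  then have "Max (?R x) \<in> ?R x" using fin by (intro Max_in) auto
  then obtain C where C: "rank P x = card C - 1" "C \<in> Chains P" "C \<subseteq> under P x"
    unfolding rank_def by auto
  \<comment> \<open>A nonempty chain of maximal length, so that adding an element raises the length.\<close>
  define D where "D = (if C = {} then {x} else C)"
  have D: "rank P x = card D - 1" "D \<in> Chains P" "D \<subseteq> under P x" "D \<noteq> {}"
    using C refl[OF Field1[OF xy(1)]] by (auto simp: D_def Chains_def under_def)
  have "y \<notin> D" using D(3) xy antisym by (auto simp: under_def)
  moreover have below: "(z, y) \<in> P" if "z \<in> D" for z
    using that D(3) trans[OF _ xy(1)] by (auto simp: under_def)
  then have "insert y D \<in> Chains P"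
    using D(2) refl[OF Field2[OF xy(1)]] by (auto simp: Chains_def)
  moreover have "insert y D \<subseteq> under P y"
    using below refl[OF Field2[OF xy(1)]] by (auto simp: under_def)
  ultimately have "card D \<in> ?R y"
    using finite_chain[OF D(2)] by (intro CollectI exI[of _ "insert y D"]) auto
  then have "card D \<le> rank P y" unfolding rank_def using fin Max_ge by blast
  moreover have "card D > 0" using D finite_chain by (simp add: card_gt_0_iff)
  ultimately show ?thesis using D(1) by linarith
qed

lemma rank_mono: "(x, y) \<in> P \<Longrightarrow> rank P x \<le> rank P y"
  using rank_strict_mono by (cases "x = y") (auto simp: less_imp_le)

definition top :: 'a where "top = top_elem P"
definition bot :: 'a where "bot = (THE x. minimal_in P x)"

lemma maximal_in_top: "maximal_in P top" and maximal_in_unique: "maximal_in P x \<Longrightarrow> x = top"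
proof -
  have "\<exists>!x. maximal_in P x" using eulerian by (simp add: eulerian_def graded_poset_def)
  note ex = this
  show "maximal_in P top" unfolding top_def top_elem_def by (rule theI'[OF ex])
  show "maximal_in P x \<Longrightarrow> x = top" unfolding top_def top_elem_def by (rule the1_equality[OF ex, symmetric])
qed

lemma minimal_in_bot: "minimal_in P bot" and minimal_in_unique: "minimal_in P x \<Longrightarrow> x = bot"
proof -
  have "\<exists>!x. minimal_in P x" using eulerian by (simp add: eulerian_def graded_poset_def)
  note ex = this
  show "minimal_in P bot" unfolding bot_def by (rule theI'[OF ex])
  show "minimal_in P x \<Longrightarrow> x = bot" unfolding bot_def by (rule the1_equality[OF ex, symmetric])
qed

text \<open>
  An element of largest rank above \<open>x\<close> is maximal, hence equal to the only maximal element.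
\<close>

lemma le_top: assumes x: "x \<in> Field P" shows "(x, top) \<in> P"
proof -
  let ?R = "rank P ` {y. (x, y) \<in> P}"
  have fin: "finite ?R" using finite_above by (rule finite_imageI)
  have "Max ?R \<in> ?R" by (rule Max_in[OF fin]) (use refl[OF x] in auto)
  then obtain y where y: "(x, y) \<in> P" "rank P y = Max ?R" by auto
  have extreme: "rank P z \<le> rank P y" if "(x, z) \<in> P" for z
    unfolding y(2) using that by (intro Max_ge[OF fin]) auto
  have "z = y" if "(y, z) \<in> P" for z
    using rank_strict_mono[OF that] extreme[OF trans[OF y(1) that]] by fastforce
  then have "maximal_in P y"
    unfolding maximal_in_def using Field2[OF y(1)] by blast
  then show ?thesis using y(1) maximal_in_unique by blast
qed

lemma bot_le: assumes x: "x \<in> Field P" shows "(bot, x) \<in> P"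
proof -
  let ?R = "rank P ` {y. (y, x) \<in> P}"
  have fin: "finite ?R" using finite_below by (rule finite_imageI)
  have "Min ?R \<in> ?R" by (rule Min_in[OF fin]) (use refl[OF x] in auto)
  then obtain y where y: "(y, x) \<in> P" "rank P y = Min ?R" by auto
  have extreme: "rank P y \<le> rank P z" if "(z, x) \<in> P" for z
    unfolding y(2) using that by (intro Min_le[OF fin]) auto
  have "z = y" if "(z, y) \<in> P" for z
    using rank_strict_mono[OF that] extreme[OF trans[OF that y(1)]] by fastforce
  then have "minimal_in P y"
    unfolding minimal_in_def using Field1[OF y(1)] by blast
  then show ?thesis using y(1) minimal_in_unique by blast
qed

lemma bot_in: "bot \<in> Field P"
  using minimal_in_bot by (simp add: minimal_in_def)

lemma rank_top: "rank P top = poset_rank P"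
  by (simp add: poset_rank_def top_def)

lemma rank_bot: "rank P bot = 0"
proof -
  have "under P bot = {bot}"
    using minimal_in_bot refl[OF bot_in] by (auto simp: under_def minimal_in_def)
  then have "{card C - 1 | C. C \<in> Chains P \<and> C \<subseteq> under P bot} = {0}"
    by (auto simp: subset_singleton_iff Chains_def intro!: exI[of _ "{}"])
  then show ?thesis by (simp add: rank_def)
qed

lemma rank_less_top: "x \<in> Field P \<Longrightarrow> x \<noteq> top \<Longrightarrow> rank P x < poset_rank P"
  using rank_strict_mono le_top rank_top by metis

abbreviation up :: "'a \<Rightarrow> 'a set" where "up x \<equiv> {y. (x, y) \<in> P \<and> y \<noteq> x}"

lemma finite_up: "finite (up x)"
  by (rule finite_subset[OF _ finite_above[of x]]) auto

text \<open>
  The chains strictly between \<open>x\<close> and \<open>top\<close>; their weighted sum is the \<open>\<^bold>a\<^bold>b\<close>-index of the interval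
  from \<open>x\<close> to \<open>top\<close>. Ranks are those of \<open>P\<close>, so that no interval has to be made into a poset of its
  own.
\<close>

definition chains_above :: "'a \<Rightarrow> 'a set set" where
  "chains_above x = {C \<in> Chains P. C \<subseteq> up x - {top}}"

definition ab_index :: "'a \<Rightarrow> (ab list \<Rightarrow>\<^sub>0 int)" where
  "ab_index x = (\<Sum>C \<in> chains_above x. chain_weight (Suc (rank P x)) (poset_rank P) (rank P ` C))"

lemma finite_chains_above: "finite (chains_above x)"
  using finite_Chains by (simp add: chains_above_def)

lemma chains_above_least:
  "chains_above x = insert {} (\<Union>y \<in> up x - {top}. insert y ` chains_above y)" (is "?L = ?R")
proof
  show "?L \<subseteq> ?R"
  proof
    fix C assume C: "C \<in> ?L"
    show "C \<in> ?R"
    proof (cases "C = {}")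
      case False
      have chain: "C \<in> Chains P" and sub: "C \<subseteq> up x - {top}" using C by (auto simp: chains_above_def)
      from finite_chain[OF chain] False obtain y
        where y: "y \<in> C" "\<And>z. z \<in> C \<Longrightarrow> rank P y \<le> rank P z"
        by (metis arg_min_if_finite(1) arg_min_least)
      have "(y, z) \<in> P" if z: "z \<in> C" for z
        using chain y z rank_strict_mono[of z y] by (force simp: Chains_def)
      then have "C - {y} \<in> chains_above y"
        using chain sub by (auto simp: chains_above_def Chains_def)
      then have "C \<in> insert y ` chains_above y"
        using y(1) by (metis image_eqI insert_Diff)
      then show ?thesis using y(1) sub by blast
    qed simp
  qed
  show "?R \<subseteq> ?L"
  proof
    fix C assume "C \<in> ?R"
    then consider "C = {}" | y D where "y \<in> up x - {top}" "D \<in> chains_above y" "C = insert y D"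
      by blast
    then show "C \<in> ?L"
    proof cases
      case 1
      then show ?thesis by (auto simp: chains_above_def Chains_def)
    next
      case (2 y D)
      have "(x, z) \<in> P \<and> z \<noteq> x" if "z \<in> D" for z
      proof -
        have "(x, y) \<in> P" "y \<noteq> x" "(y, z) \<in> P" using 2 that by (auto simp: chains_above_def)
        then show ?thesis using trans[of x y z] antisym[of x y] by blast
      qed
      then show ?thesis
        using 2 refl[OF Field2[of x y]] by (auto simp: chains_above_def Chains_def)
    qed
  qed
qed

lemma notin_chains_above: "C \<in> chains_above y \<Longrightarrow> y \<notin> C"
  by (auto simp: chains_above_def)

text \<open>
  A nonempty chain is split at its least element \<open>y\<close>: the ranks below \<open>y\<close> are all missed, \<open>y\<close>
  contributes \<open>\<^bold>b\<close>, and the rest is a chain above \<open>y\<close>.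
\<close>

lemma ab_index_least:
  assumes "x \<in> Field P"
  shows "ab_index x = a_minus_b ^ (poset_rank P - rank P x - 1) +
    (\<Sum>y \<in> up x - {top}. a_minus_b ^ (rank P y - rank P x - 1) * (letter LB * ab_index y))"
proof -
  let ?w = "\<lambda>C. chain_weight (Suc (rank P x)) (poset_rank P) (rank P ` C)"
  have disj: "insert y ` chains_above y \<inter> insert z ` chains_above z = {}"
    if "y \<noteq> z" for y z
  proof -
    have False if "insert y C = insert z D" "C \<in> chains_above y" "D \<in> chains_above z" for C D
    proof -
      have "z \<in> C" "y \<in> D" using that(1) \<open>y \<noteq> z\<close> by (metis insertE insertI1)+
      then show False using that(2,3) antisym[of y z] \<open>y \<noteq> z\<close> by (auto simp: chains_above_def)
    qed
    then show ?thesis by blast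
  qed
  have inj: "inj_on (insert y) (chains_above y)" for y
    by (metis inj_onI insert_ident notin_chains_above)
  have w: "?w (insert y C) = a_minus_b ^ (rank P y - rank P x - 1) *
      (letter LB * chain_weight (Suc (rank P y)) (poset_rank P) (rank P ` C))"
    if "y \<in> up x - {top}" "C \<in> chains_above y" for y C
  proof -
    have "rank P x < rank P y" "rank P y < poset_rank P"
      using that(1) rank_strict_mono[of x y] rank_less_top[OF Field2[of x y]] by auto
    moreover have "rank P y < i" if "i \<in> rank P ` C" for i
      using that \<open>C \<in> chains_above y\<close> by (auto simp: chains_above_def intro!: rank_strict_mono)
    ultimately show ?thesis
      using chain_weight_split[of "Suc (rank P x)" "rank P y" "poset_rank P" "rank P ` C"] by simp
  qed
  have "ab_index x = ?w {} + (\<Sum>C \<in> (\<Union>y \<in> up x - {top}. insert y ` chains_above y). ?w C)"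
    unfolding ab_index_def
    by (subst chains_above_least, subst sum.insert)
      (use finite_up finite_chains_above in auto)
  also have "(\<Sum>C \<in> (\<Union>y \<in> up x - {top}. insert y ` chains_above y). ?w C) =
      (\<Sum>y \<in> up x - {top}. \<Sum>C \<in> insert y ` chains_above y. ?w C)"
    using finite_up finite_chains_above disj by (intro sum.UNION_disjoint) auto
  also have "\<dots> = (\<Sum>y \<in> up x - {top}. \<Sum>C \<in> chains_above y. ?w (insert y C))"
    using inj by (simp add: sum.reindex)
  also have "\<dots> = (\<Sum>y \<in> up x - {top}. \<Sum>C \<in> chains_above y. a_minus_b ^ (rank P y - rank P x - 1) *
      (letter LB * chain_weight (Suc (rank P y)) (poset_rank P) (rank P ` C)))"
    using w by (intro sum.cong) auto
  also have "\<dots> = (\<Sum>y \<in> up x - {top}. a_minus_b ^ (rank P y - rank P x - 1) * (letter LB * ab_index y))"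
    by (simp add: ab_index_def sum_distrib_left)
  finally show ?thesis by (simp add: chain_weight_empty)
qed

text \<open>
  Giving \<open>top\<close> the value \<open>1\<close> absorbs the empty chain into the sum over \<open>y\<close> in \<open>ab_index_least\<close>:
  \<open>top\<close> then plays the role of the least element of the empty chain.
\<close>

definition tail :: "ab \<Rightarrow> 'a \<Rightarrow> (ab list \<Rightarrow>\<^sub>0 int)" where
  "tail l y = (if y = top then 1 else letter l * ab_index y)"

lemma ab_index_tail_b:
  assumes "x \<in> Field P" "x \<noteq> top"
  shows "ab_index x = (\<Sum>y \<in> up x. a_minus_b ^ (rank P y - rank P x - 1) * tail LB y)"
proof -
  have "top \<in> up x" using assms le_top[of x] by auto
  then show ?thesis
    unfolding ab_index_least[OF assms(1)]
    by (subst sum.remove[OF finite_up, of top]) (auto simp: tail_def rank_top)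
qed

text \<open>
  For \<open>y \<noteq> top\<close> the difference of the two tails at \<open>y\<close> is \<open>(\<^bold>a - \<^bold>b) * ab_index y\<close>, which
  \<open>ab_index_tail_b\<close> expands over the elements strictly above \<open>y\<close>. So the tails with \<open>\<^bold>a\<close> arise from
  those with \<open>\<^bold>b\<close> by a zeta matrix weighted by powers of \<open>\<^bold>a - \<^bold>b\<close>.
\<close>

lemma tail_a_eq:
  assumes "y \<in> Field P"
  shows "tail LA y = (\<Sum>z | (y, z) \<in> P. a_minus_b ^ (rank P z - rank P y) * tail LB z)"
proof -
  have set: "{z. (y, z) \<in> P} = insert y (up y)" using refl[OF assms] by auto
  have "(\<Sum>z | (y, z) \<in> P. a_minus_b ^ (rank P z - rank P y) * tail LB z) =
      tail LB y + (\<Sum>z \<in> up y. a_minus_b ^ (rank P z - rank P y) * tail LB z)"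
    unfolding set using finite_up by (subst sum.insert) auto
  also have "(\<Sum>z \<in> up y. a_minus_b ^ (rank P z - rank P y) * tail LB z) =
      (\<Sum>z \<in> up y. a_minus_b * (a_minus_b ^ (rank P z - rank P y - 1) * tail LB z))"
  proof (rule sum.cong)
    fix z assume "z \<in> up y"
    then have "rank P y < rank P z" using rank_strict_mono[of y z] by auto
    then have "rank P z - rank P y = Suc (rank P z - rank P y - 1)" by simp
    then show "a_minus_b ^ (rank P z - rank P y) * tail LB z =
        a_minus_b * (a_minus_b ^ (rank P z - rank P y - 1) * tail LB z)"
      by (metis mult.assoc power_Suc)
  qed simp
  also have "tail LB y + \<dots> = tail LA y"
  proof (cases "y = top")
    case True
    then have "up y = {}" using maximal_in_top by (auto simp: maximal_in_def)
    then show ?thesis unfolding \<open>up y = {}\<close> sum.empty using True by (simp add: tail_def)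
  next
    case False
    then show ?thesis
      unfolding sum_distrib_left[symmetric] ab_index_tail_b[OF assms False, symmetric]
      by (simp add: tail_def a_minus_b_def algebra_simps)
  qed
  finally show ?thesis by simp
qed

text \<open>
  The recursion of the Moebius function says that its values sum to \<open>0\<close> over the interval; in an
  Eulerian poset these values are signs. Removing \<open>y = x\<close> and shifting the exponent by one gives \<open>1\<close>.
\<close>

lemma euler_relation:
  assumes "(x, z) \<in> P" "x \<noteq> z"
  shows "(\<Sum>y | y \<in> up x \<and> (y, z) \<in> P. (- 1) ^ (rank P y - rank P x - 1)) = (1 :: int)"
proof -
  let ?I = "{y. (x, y) \<in> P \<and> (y, z) \<in> P}" and ?s = "\<lambda>y. (- 1 :: int) ^ (rank P y - rank P x)"
  have mu: "moebius P u v = (- 1) ^ (rank P v - rank P u)" if "(u, v) \<in> P" for u v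
    using eulerian that by (simp add: eulerian_def)
  have fin: "finite ?I" by (rule finite_subset[OF _ finite_above[of x]]) auto
  have "?s z = moebius P x z" using mu[OF assms(1)] by simp
  also have "\<dots> = - (\<Sum>y \<in> {y. (x, y) \<in> P \<and> (y, z) \<in> P \<and> y \<noteq> z}. moebius P x y)"
    using assms finite_Field partial_order by (subst moebius.simps) simp
  also have "(\<Sum>y \<in> {y. (x, y) \<in> P \<and> (y, z) \<in> P \<and> y \<noteq> z}. moebius P x y) = sum ?s (?I - {z})"
    using mu by (intro sum.cong) auto
  finally have "0 = ?s z + sum ?s (?I - {z})" by simp
  also have "\<dots> = sum ?s ?I"
    using fin assms refl[OF Field2[OF assms(1)]] by (subst (2) sum.remove[of _ z]) auto
  also have "\<dots> = ?s x + sum ?s (?I - {x})"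
    using fin assms refl[OF Field1[OF assms(1)]] by (subst sum.remove[of _ x]) auto
  also have "?I - {x} = {y. y \<in> up x \<and> (y, z) \<in> P}" by auto
  also have "sum ?s {y. y \<in> up x \<and> (y, z) \<in> P} =
      (\<Sum>y | y \<in> up x \<and> (y, z) \<in> P. - ((- 1) ^ (rank P y - rank P x - 1)))"
  proof (rule sum.cong)
    fix y assume "y \<in> {y. y \<in> up x \<and> (y, z) \<in> P}"
    then have "rank P x < rank P y" using rank_strict_mono[of x y] by auto
    then have "rank P y - rank P x = Suc (rank P y - rank P x - 1)" by simp
    then show "?s y = - ((- 1) ^ (rank P y - rank P x - 1))"
      by (metis mult_minus1 power_Suc)
  qed simp
  finally show ?thesis by (simp add: sum_negf)
qed

text \<open>
  The companion of \<open>ab_index_tail_b\<close> with \<open>\<^bold>a\<close> and \<open>\<^bold>b\<close> exchanged, so that \<open>\<^bold>a - \<^bold>b\<close> changes its sign: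
  this is the symmetry \<open>h\<^sub>S = h\<^bsub>[n] - S\<^esub>\<close> of Eulerian posets. Expanding the tails with \<open>\<^bold>a\<close> by
  \<open>tail_a_eq\<close> and exchanging the sums leaves at each \<open>z\<close> the alternating sum of \<open>euler_relation\<close>.
\<close>

lemma ab_index_tail_a:
  assumes "x \<in> Field P" "x \<noteq> top"
  shows "ab_index x = (\<Sum>y \<in> up x. (- a_minus_b) ^ (rank P y - rank P x - 1) * tail LA y)"
proof -
  let ?t = "\<lambda>y z. of_int ((- 1) ^ (rank P y - rank P x - 1)) *
    (a_minus_b ^ (rank P z - rank P x - 1) * tail LB z)"
  have "(\<Sum>y \<in> up x. (- a_minus_b) ^ (rank P y - rank P x - 1) * tail LA y) =
      (\<Sum>y \<in> up x. \<Sum>z | z \<in> up x \<and> (y, z) \<in> P. ?t y z)"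
  proof (rule sum.cong)
    fix y assume y: "y \<in> up x"
    have rxy: "rank P x < rank P y" using y rank_strict_mono[of x y] by auto
    have set: "{z. (y, z) \<in> P} = {z. z \<in> up x \<and> (y, z) \<in> P}"
      using y by (auto intro: trans dest: antisym)
    have "(- a_minus_b) ^ (rank P y - rank P x - 1) * (a_minus_b ^ (rank P z - rank P y) * tail LB z) = ?t y z"
      if "(y, z) \<in> P" for z
    proof -
      have "rank P z - rank P x - 1 = (rank P y - rank P x - 1) + (rank P z - rank P y)"
        using rxy rank_mono[OF that] by simp
      then show ?thesis
        by (simp add: power_add power_minus[of a_minus_b] mult.assoc del: diff_diff_left)
    qed
    then show "(- a_minus_b) ^ (rank P y - rank P x - 1) * tail LA y =
        (\<Sum>z | z \<in> up x \<and> (y, z) \<in> P. ?t y z)"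
      unfolding tail_a_eq[OF Field2[of x y]] set[symmetric] sum_distrib_left
      using y by (subst tail_a_eq) (auto simp: sum_distrib_left Field2 intro!: sum.cong)
  qed simp
  also have "\<dots> = (\<Sum>z \<in> up x. \<Sum>y | y \<in> up x \<and> (y, z) \<in> P. ?t y z)"
    by (rule sum.swap_restrict) (rule finite_up)+
  also have "\<dots> = (\<Sum>z \<in> up x. of_int (\<Sum>y | y \<in> up x \<and> (y, z) \<in> P. (- 1) ^ (rank P y - rank P x - 1)) *
      (a_minus_b ^ (rank P z - rank P x - 1) * tail LB z))"
    unfolding of_int_sum sum_distrib_right ..
  also have "\<dots> = (\<Sum>z \<in> up x. a_minus_b ^ (rank P z - rank P x - 1) * tail LB z)"
  proof (rule sum.cong)
    fix z assume "z \<in> up x"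
    then have "(\<Sum>y | y \<in> up x \<and> (y, z) \<in> P. (- 1 :: int) ^ (rank P y - rank P x - 1)) = 1"
      by (intro euler_relation) auto
    then show "of_int (\<Sum>y | y \<in> up x \<and> (y, z) \<in> P. (- 1) ^ (rank P y - rank P x - 1)) *
        (a_minus_b ^ (rank P z - rank P x - 1) * tail LB z) =
        a_minus_b ^ (rank P z - rank P x - 1) * tail LB z"
      by (simp only: of_int_1 mult_1_left)
  qed simp
  also have "\<dots> = ab_index x" using ab_index_tail_b[OF assms] by simp
  finally show ?thesis by simp
qed

text \<open>
  The sum of \<open>ab_index_tail_b\<close> and \<open>ab_index_tail_a\<close> is symmetric in \<open>\<^bold>a\<close> and \<open>\<^bold>b\<close>. With \<open>k\<close> the
  rank difference of \<open>x\<close> and \<open>y \<noteq> top\<close>, the summand at \<open>y\<close> is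
  \<open>(\<^bold>a - \<^bold>b)\<^bsup>k-1\<^esup> (\<^bold>b \<plusminus> \<^bold>a)\<close> times the \<open>\<^bold>a\<^bold>b\<close>-index of \<open>y\<close>. If \<open>k\<close> is odd the second factor is \<open>\<^bold>c\<close>, and if
  \<open>k\<close> is even it is \<open>-(\<^bold>a - \<^bold>b)\<close>; in both cases only even powers of \<open>\<^bold>a - \<^bold>b\<close> remain. At \<open>top\<close> the
  odd powers cancel.
\<close>

lemma ab_index_cd:
  assumes "x \<in> Field P" "x \<noteq> top"
  shows "ab_index x \<in> cd_polynomials (poset_rank P - rank P x - 1)"
  using assms
proof (induction "poset_rank P - rank P x" arbitrary: x rule: less_induct)
  case less
  let ?N = "poset_rank P"
  have "ab_index x + ab_index x = (\<Sum>y \<in> up x. a_minus_b ^ (rank P y - rank P x - 1) * tail LB y +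
      (- a_minus_b) ^ (rank P y - rank P x - 1) * tail LA y)"
    using ab_index_tail_a[OF less.prems] ab_index_tail_b[OF less.prems] by (simp add: sum.distrib)
  also have "\<dots> \<in> cd_polynomials (?N - rank P x - 1)"
  proof (rule cd_polynomials_sum)
    fix y assume y: "y \<in> up x"
    have rxy: "rank P x < rank P y" using y rank_strict_mono[of x y] by auto
    obtain j where j: "rank P y - rank P x - 1 = 2 * j \<or> rank P y - rank P x - 1 = Suc (2 * j)"
      by (metis oddE evenE Suc_eq_plus1)
    let ?s = "a_minus_b ^ (rank P y - rank P x - 1) * tail LB y +
      (- a_minus_b) ^ (rank P y - rank P x - 1) * tail LA y"
    show "?s \<in> cd_polynomials (?N - rank P x - 1)"
    proof (cases "y = top")
      case True
      have "of_int 2 \<in> cd_polynomials 0" by (rule of_int_cd_polynomials)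
      from cd_polynomials_even_power_mult[OF this, of j]
      have "a_minus_b ^ (2 * j) + a_minus_b ^ (2 * j) \<in> cd_polynomials (2 * j)"
        by (simp add: mult_2_right)
      then show ?thesis
        using j True by (auto simp: tail_def rank_top cd_polynomials_0 simp del: diff_diff_left)
    next
      case False
      have yF: "y \<in> Field P" using y Field2[of x y] by blast
      have ry: "rank P y < ?N" using rank_less_top[OF yF False] by simp
      have IH: "ab_index y \<in> cd_polynomials (?N - rank P y - 1)"
        using less.hyps[of y] rxy ry yF False by simp
      from j show ?thesis
      proof
        assume e: "rank P y - rank P x - 1 = 2 * j"
        have "?s = a_minus_b ^ (2 * j) * (cd_to_ab LC * ab_index y)"
          unfolding e using False by (simp add: tail_def algebra_simps)
        moreover have "Suc (?N - rank P y - 1) + 2 * j = ?N - rank P x - 1"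
          using e rxy ry by linarith
        ultimately show ?thesis
          using cd_polynomials_even_power_mult[OF cd_polynomials_c_mult[OF IH], of j] by simp
      next
        assume e: "rank P y - rank P x - 1 = Suc (2 * j)"
        have "(- a_minus_b) ^ Suc (2 * j) = - (a_minus_b ^ Suc (2 * j))"
          using power_minus_odd[of "Suc (2 * j)" a_minus_b] by simp
        moreover have e_mult: "a_minus_b * ab_index y = letter LA * ab_index y - letter LB * ab_index y"
          by (simp add: a_minus_b_def left_diff_distrib)
        moreover have "a_minus_b ^ (2 * Suc j) = a_minus_b ^ Suc (2 * j) * a_minus_b"
          by (simp add: power_commutes mult.assoc)
        ultimately have "?s = - (a_minus_b ^ (2 * Suc j) * ab_index y)"
          unfolding e using False
          by (simp only: tail_def if_False) (simp add: mult.assoc right_diff_distrib del: power_Suc)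
        moreover have "(?N - rank P y - 1) + 2 * Suc j = ?N - rank P x - 1"
        proof -
          have "rank P y = rank P x + 2 * j + 2" using e rxy by simp
          then show ?thesis using ry by simp
        qed
        ultimately show ?thesis
          using cd_polynomials_uminus[OF cd_polynomials_even_power_mult[OF IH, of "Suc j"]] by simp
      qed
    qed
  qed
  finally show ?case by (rule cd_polynomials_half)
qed

end

section \<open>The flag h-vector in terms of weighted chains\<close>

lemma prod_list_zero: "x \<in> set xs \<Longrightarrow> f x = 0 \<Longrightarrow> prod_list (map f xs) = (0 :: 'b :: semiring_1)"
  by (induction xs) auto

lemma prod_list_add_expand:
  fixes g h :: "'i \<Rightarrow> 'b :: semiring_1"
  assumes "distinct xs"
  shows "prod_list (map (\<lambda>i. g i + h i) xs) =
    (\<Sum>T \<in> Pow (set xs). prod_list (map (\<lambda>i. if i \<in> T then g i else h i) xs))"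
  using assms
proof (induction xs)
  case (Cons x xs)
  let ?p = "\<lambda>T ys. prod_list (map (\<lambda>i. if i \<in> T then g i else h i) ys)"
  have x: "x \<notin> set xs" and d: "distinct xs" using Cons.prems by auto
  have eq: "?p (insert x T) xs = ?p T xs" for T
    using x by (intro arg_cong[where f = prod_list] map_cong) auto
  have ne: "x \<notin> T" if "T \<in> Pow (set xs)" for T using that x by auto
  have "(\<Sum>T \<in> Pow (set (x # xs)). ?p T (x # xs)) =
      (\<Sum>T \<in> Pow (set xs). ?p T (x # xs)) + (\<Sum>T \<in> insert x ` Pow (set xs). ?p T (x # xs))"
    unfolding list.set Pow_insert using x by (subst sum.union_disjoint) auto
  also have "(\<Sum>T \<in> insert x ` Pow (set xs). ?p T (x # xs)) =
      (\<Sum>T \<in> Pow (set xs). ?p (insert x T) (x # xs))"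
    using x by (subst sum.reindex) (auto simp: inj_on_def)
  also have "\<dots> = g x * (\<Sum>T \<in> Pow (set xs). ?p T xs)"
    unfolding sum_distrib_left by (rule sum.cong[OF refl]) (simp add: eq insertI1 del: insert_iff)
  also have "(\<Sum>T \<in> Pow (set xs). ?p T (x # xs)) = h x * (\<Sum>T \<in> Pow (set xs). ?p T xs)"
    unfolding sum_distrib_left by (rule sum.cong) (use ne in auto)
  finally show ?case
    using Cons.IH[OF d] by (simp add: algebra_simps)
qed simp

text \<open>
  Write \<open>\<^bold>a = \<^bold>b + (\<^bold>a - \<^bold>b)\<close> at every position outside \<open>S\<close> and multiply out.
\<close>

lemma u_monomial_eq_sum:
  assumes "S \<subseteq> {1..n}"
  shows "u_monomial n S = (\<Sum>T | T \<in> Pow {1..n} \<and> S \<subseteq> T. chain_weight 1 (Suc n) T)"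
proof -
  \<comment> \<open>The zero at positions in \<open>S\<close> removes every \<open>T\<close> that does not contain \<open>S\<close>.\<close>
  let ?h = "\<lambda>i. if i \<in> S then 0 else a_minus_b"
  have set: "set [1..<Suc n] = {1..n}" by auto
  have "u_monomial n S = prod_list (map (\<lambda>i. letter LB + ?h i) [1..<Suc n])"
    unfolding u_monomial_def a_minus_b_def by (intro arg_cong[where f = prod_list] map_cong) auto
  also have "\<dots> = (\<Sum>T \<in> Pow {1..n}. prod_list (map (\<lambda>i. if i \<in> T then letter LB else ?h i) [1..<Suc n]))"
    unfolding set[symmetric] by (rule prod_list_add_expand) simp
  also have "\<dots> = (\<Sum>T \<in> {T \<in> Pow {1..n}. S \<subseteq> T}. prod_list (map (\<lambda>i. if i \<in> T then letter LB else ?h i) [1..<Suc n]))"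
  proof (intro sum.mono_neutral_right ballI)
    fix T assume "T \<in> Pow {1..n} - {T \<in> Pow {1..n}. S \<subseteq> T}"
    then obtain i where "i \<in> S" "i \<notin> T" by auto
    then show "prod_list (map (\<lambda>i. if i \<in> T then letter LB else ?h i) [1..<Suc n]) = 0"
      using assms by (intro prod_list_zero[of i]) auto
  qed auto
  also have "\<dots> = (\<Sum>T | T \<in> Pow {1..n} \<and> S \<subseteq> T. chain_weight 1 (Suc n) T)"
    unfolding chain_weight_def
    by (intro sum.cong refl arg_cong[where f = prod_list] map_cong) auto
  finally show ?thesis .
qed

lemma sum_flag_h_eq_sum_flag_f:
  "(\<Sum>S \<in> Pow {1..n}. of_int (flag_h P S) * u_monomial n S) =
   (\<Sum>T \<in> Pow {1..n}. of_nat (flag_f P T) * chain_weight 1 (Suc n) T)"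
proof -
  have "(\<Sum>S \<in> Pow {1..n}. of_int (flag_h P S) * u_monomial n S) =
      (\<Sum>S \<in> Pow {1..n}. \<Sum>T | T \<in> Pow {1..n} \<and> S \<subseteq> T. of_int (flag_h P S) * chain_weight 1 (Suc n) T)"
    by (simp add: u_monomial_eq_sum sum_distrib_left)
  also have "\<dots> = (\<Sum>T \<in> Pow {1..n}. \<Sum>S | S \<in> Pow {1..n} \<and> S \<subseteq> T. of_int (flag_h P S) * chain_weight 1 (Suc n) T)"
    by (rule sum.swap_restrict) auto
  also have "\<dots> = (\<Sum>T \<in> Pow {1..n}. of_nat (flag_f P T) * chain_weight 1 (Suc n) T)"
  proof (rule sum.cong)
    fix T :: "nat set" assume T: "T \<in> Pow {1..n}"
    then have "{S. S \<in> Pow {1..n} \<and> S \<subseteq> T} = Pow T" by auto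
    moreover have "of_nat (flag_f P T) = (of_int (\<Sum>S \<in> Pow T. flag_h P S) :: ab list \<Rightarrow>\<^sub>0 int)"
      using T flag_f_eq_sum_flag_h[of T P] finite_subset by (metis Pow_iff finite_atLeastAtMost of_int_of_nat_eq)
    ultimately show "(\<Sum>S | S \<in> Pow {1..n} \<and> S \<subseteq> T. of_int (flag_h P S) * chain_weight 1 (Suc n) T) =
        of_nat (flag_f P T) * chain_weight 1 (Suc n) T"
      by (simp add: sum_distrib_right)
  qed simp
  finally show ?thesis .
qed

context eulerian_poset
begin

text \<open>
  The chains strictly between \<open>bot\<close> and \<open>top\<close> are those with ranks in \<open>{1..n}\<close>; grouped by their
  set of ranks, they give the flag numbers.
\<close>

lemma ab_index_bot:
  assumes "poset_rank P = Suc n"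
  shows "ab_index bot = (\<Sum>S \<in> Pow {1..n}. of_int (flag_h P S) * u_monomial n S)"
proof -
  let ?w = "chain_weight 1 (Suc n)"
  have mid: "y \<in> up bot - {top} \<longleftrightarrow> rank P y \<in> {1..n}" if "y \<in> Field P" for y
    using that bot_le[OF that] rank_less_top[OF that] rank_strict_mono[of bot y] rank_bot rank_top assms
    by auto
  have C: "{C \<in> chains_above bot. rank P ` C = T} = {C. C \<in> Chains P \<and> rank P ` C = T}"
    if "T \<in> Pow {1..n}" for T
    using that mid Chains_subset_Field unfolding chains_above_def by blast
  have "rank P ` C \<in> Pow {1..n}" if "C \<in> chains_above bot" for C
    using that mid Chains_subset_Field unfolding chains_above_def by blast
  then have "ab_index bot = (\<Sum>T \<in> Pow {1..n}. \<Sum>C | C \<in> chains_above bot \<and> rank P ` C = T. ?w (rank P ` C))"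
    unfolding ab_index_def using assms finite_chains_above
    by (subst sum.group) (auto simp: rank_bot)
  also have "\<dots> = (\<Sum>T \<in> Pow {1..n}. of_nat (flag_f P T) * ?w T)"
  proof (rule sum.cong)
    fix T assume T: "T \<in> Pow {1..n}"
    have "(\<Sum>C | C \<in> chains_above bot \<and> rank P ` C = T. ?w (rank P ` C)) =
        (\<Sum>C | C \<in> chains_above bot \<and> rank P ` C = T. ?w T)" by (rule sum.cong) auto
    then show "(\<Sum>C | C \<in> chains_above bot \<and> rank P ` C = T. ?w (rank P ` C)) = of_nat (flag_f P T) * ?w T"
      using C[OF T] by (simp add: flag_f_def)
  qed simp
  finally show ?thesis using sum_flag_h_eq_sum_flag_f by metis
qed

end


section \<open>Existence and uniqueness of the cd-index\<close>

lemma cd_subst_eq_cd_combination: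
  assumes "\<forall>w \<in> Poly_Mapping.keys \<psi>. cd_degree w = n"
  shows "cd_subst \<psi> = cd_combination n (Poly_Mapping.lookup \<psi>)"
  unfolding cd_subst_def cd_combination_def
  using assms finite_cd_degree
  by (intro sum.mono_neutral_left) (auto simp: in_keys_iff)

lemma cd_combination_inject:
  assumes "cd_combination n \<phi> = cd_combination n \<chi>" and "cd_degree w = n"
  shows "\<phi> w = \<chi> w"
proof -
  have "cd_combination n (\<lambda>w. \<phi> w - \<chi> w) = cd_combination n \<phi> - cd_combination n \<chi>"
    by (simp add: cd_combination_def sum_subtractf algebra_simps)
  then have "0 dvd coeff (cd_combination n (\<lambda>w. \<phi> w - \<chi> w)) v" for v
    using assms(1) by simp
  from cd_combination_dvd[OF this assms(2)] show ?thesis by simp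
qed

text \<open>
  \<open>cd_index\<close> is a definite description, so this needs both existence, from \<open>ab_index_cd\<close> at the least
  element, and uniqueness, from the independence of the \<open>\<^bold>c\<^bold>d\<close>-monomials.
\<close>

lemma cd_combination_cd_index:
  assumes "eulerian P" and N: "poset_rank P = Suc n"
  shows "cd_combination n (Poly_Mapping.lookup (cd_index P)) =
    (\<Sum>S \<in> Pow {1..n}. of_int (flag_h P S) * u_monomial n S)" (is "_ = ?ab")
proof -
  interpret eulerian_poset P using assms(1) by unfold_locales
  have "bot \<noteq> top" using rank_bot rank_top N by auto
  then have "?ab \<in> cd_polynomials n"
    using ab_index_cd[OF bot_in] ab_index_bot[OF N] rank_bot N by simp
  then obtain \<phi> where \<phi>: "?ab = cd_combination n \<phi>" by (auto simp: cd_polynomials_def)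
  define \<psi> where "\<psi> = Abs_poly_mapping (\<lambda>w. if cd_degree w = n then \<phi> w else 0)"
  have "finite {w. (if cd_degree w = n then \<phi> w else 0) \<noteq> 0}"
    by (rule finite_subset[OF _ finite_cd_degree[of n]]) auto
  then have look: "Poly_Mapping.lookup \<psi> = (\<lambda>w. if cd_degree w = n then \<phi> w else 0)"
    unfolding \<psi>_def by (simp add: Abs_poly_mapping_inverse)
  then have keys: "\<forall>w \<in> Poly_Mapping.keys \<psi>. cd_degree w = n" by (auto simp: in_keys_iff split: if_splits)
  have "cd_combination n (Poly_Mapping.lookup \<psi>) = ?ab"
    unfolding \<phi> look by (simp add: cd_combination_def)
  then have ex: "is_cd_index P \<psi>"
    using keys N cd_subst_eq_cd_combination[OF keys] by (simp add: is_cd_index_def)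
  have unique: "\<chi> = \<psi>" if \<chi>: "is_cd_index P \<chi>" for \<chi>
  proof (rule poly_mapping_eqI)
    fix w
    have keys': "\<forall>w \<in> Poly_Mapping.keys \<chi>. cd_degree w = n" and "cd_subst \<chi> = ?ab"
      using \<chi> N by (simp_all add: is_cd_index_def)
    then have "cd_combination n (Poly_Mapping.lookup \<chi>) = cd_combination n (Poly_Mapping.lookup \<psi>)"
      using cd_subst_eq_cd_combination[OF keys'] \<open>cd_combination n (Poly_Mapping.lookup \<psi>) = ?ab\<close> by simp
    then show "Poly_Mapping.lookup \<chi> w = Poly_Mapping.lookup \<psi> w"
      using cd_combination_inject[of n _ _ w] keys keys' by (metis in_keys_iff)
  qed
  have "cd_index P = \<psi>"
    unfolding cd_index_def by (rule the_equality[of "is_cd_index P", OF ex unique])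
  then show ?thesis using \<open>cd_combination n (Poly_Mapping.lookup \<psi>) = ?ab\<close> by simp
qed

section \<open>Counting the ab-words in a cd-monomial\<close>

text \<open>
  The word \<open>u\<^sub>S\<close> restricted to the positions \<open>k + 1, \<dots>, k + d\<close>; the offset \<open>k\<close> allows an induction
  that strips letters from the left while \<open>S\<close> stays the same.
\<close>

definition ab_word :: "nat \<Rightarrow> nat \<Rightarrow> nat set \<Rightarrow> ab list" where
  "ab_word k d S = map (\<lambda>i. if i \<in> S then LB else LA) [Suc k..<Suc (k + d)]"

lemma ab_word_0: "ab_word k 0 S = []"
  by (simp add: ab_word_def)

lemma ab_word_Suc:
  "ab_word k (Suc d) S = (if Suc k \<in> S then LB else LA) # ab_word (Suc k) d S"
proof -
  have "[Suc k..<Suc (k + Suc d)] = Suc k # [Suc (Suc k)..<Suc (Suc k + d)]"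
    by (subst upt_conv_Cons) auto
  then show ?thesis by (simp add: ab_word_def del: upt_Suc)
qed

lemma ab_word_insert: "j \<le> k \<Longrightarrow> ab_word k d (insert j S) = ab_word k d S"
  by (auto simp: ab_word_def)

lemma u_monomial_eq_single: "u_monomial n S = Poly_Mapping.single (ab_word 0 n S) 1"
proof -
  have one: "1 = Poly_Mapping.single ([] :: ab list) (1 :: int)"
    by (simp flip: zero_list_def)
  have "prod_list (map (\<lambda>i. letter (g i)) xs) = Poly_Mapping.single (map g xs) 1"
    for g :: "nat \<Rightarrow> ab" and xs
    by (induction xs) (simp_all add: one letter_def mult_single plus_list_def)
  from this[of "\<lambda>i. if i \<in> S then LB else LA" "[1..<Suc n]"] show ?thesis
    unfolding u_monomial_def ab_word_def by (simp add: if_distrib del: upt_Suc)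
qed

lemma ab_word_inject:
  assumes "ab_word 0 n S = ab_word 0 n T" "S \<subseteq> {1..n}" "T \<subseteq> {1..n}"
  shows "S = T"
proof -
  have "i \<in> S \<longleftrightarrow> i \<in> T" if "i \<in> {1..n}" for i
  proof -
    have "i \<in> set [Suc 0..<Suc (0 + n)]" using that by auto
    then have "(if i \<in> S then LB else LA) = (if i \<in> T then LB else LA)"
      using assms(1) unfolding ab_word_def map_eq_conv by blast
    then show ?thesis by (simp split: if_splits)
  qed
  then show ?thesis using assms(2,3) by blast
qed

lemma coeff_sum_u_monomial:
  assumes "S \<subseteq> {1..n}"
  shows "coeff (\<Sum>T \<in> Pow {1..n}. of_int (h T) * u_monomial n T) (ab_word 0 n S) = h S"
proof -
  have "coeff (\<Sum>T \<in> Pow {1..n}. of_int (h T) * u_monomial n T) (ab_word 0 n S) =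
      (\<Sum>T \<in> Pow {1..n}. if T = S then h T else 0)"
    unfolding lookup_sum
    using assms ab_word_inject
    by (intro sum.cong) (auto simp: coeff_of_int_mult u_monomial_eq_single lookup_single when_def)
  also have "\<dots> = h S" using assms by simp
  finally show ?thesis .
qed

lemma greaterThanAtMost_Suc: "{k<..k + Suc d} = insert (Suc k) {Suc k<..Suc k + d}"
  by auto

lemma sum_Pow_ab_word:
  fixes g :: "ab list \<Rightarrow> int"
  shows "(\<Sum>S \<in> Pow (T \<inter> {k<..k + Suc d}). g (ab_word k (Suc d) S)) =
    (\<Sum>S \<in> Pow (T \<inter> {Suc k<..Suc k + d}). g (LA # ab_word (Suc k) d S)) +
    (if Suc k \<in> T then \<Sum>S \<in> Pow (T \<inter> {Suc k<..Suc k + d}). g (LB # ab_word (Suc k) d S) else 0)"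
proof -
  let ?A = "T \<inter> {Suc k<..Suc k + d}"
  have notin: "Suc k \<notin> S" if "S \<in> Pow ?A" for S using that by auto
  have LA: "(\<Sum>S \<in> Pow ?A. g (ab_word k (Suc d) S)) = (\<Sum>S \<in> Pow ?A. g (LA # ab_word (Suc k) d S))"
    using notin by (intro sum.cong) (auto simp: ab_word_Suc)
  show ?thesis
  proof (cases "Suc k \<in> T")
    case False
    then have "T \<inter> {k<..k + Suc d} = ?A"
      unfolding greaterThanAtMost_Suc by simp
    then show ?thesis using LA False by simp
  next
    case True
    then have set: "T \<inter> {k<..k + Suc d} = insert (Suc k) ?A"
      unfolding greaterThanAtMost_Suc by simp
    have "inj_on (insert (Suc k)) (Pow ?A)"
      by (rule inj_onI) (metis insert_ident notin)
    then have "(\<Sum>S \<in> insert (Suc k) ` Pow ?A. g (ab_word k (Suc d) S)) =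
        (\<Sum>S \<in> Pow ?A. g (ab_word k (Suc d) (insert (Suc k) S)))"
      by (simp add: sum.reindex)
    also have "\<dots> = (\<Sum>S \<in> Pow ?A. g (LB # ab_word (Suc k) d S))"
      by (simp add: ab_word_Suc ab_word_insert)
    finally show ?thesis
      unfolding set Pow_insert using LA True
      by (subst sum.union_disjoint) auto
  qed
qed

lemma coeff_c_mult: "coeff (cd_to_ab LC * p) (x # v) = coeff p v"
  by (cases x) (simp_all add: distrib_right lookup_add coeff_letter_mult)

lemma coeff_d_mult: "coeff (cd_to_ab LD * p) (x # y # v) = (if x = y then 0 else coeff p v)"
  by (cases x; cases y) (simp_all add: distrib_right lookup_add mult.assoc coeff_letter_mult)

lemma S_word_Nil: "S_word [] = {}"
  by (simp add: S_word_def)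

lemma S_word_append: "Suc (Suc (cd_degree u)) \<in> S_word (u @ LD # v)"
  unfolding S_word_def by (intro CollectI exI[of _ u] exI[of _ v]) simp

lemma S_word_cases:
  assumes "s \<in> S_word w"
  obtains u v where "w = u @ LD # v" "s = Suc (Suc (cd_degree u))"
  using assms by (auto simp: S_word_def)

lemma S_word_C: "S_word (LC # w) = Suc ` S_word w"
proof
  show "S_word (LC # w) \<subseteq> Suc ` S_word w"
    by (auto elim!: S_word_cases simp: Cons_eq_append_conv intro!: imageI S_word_append)
  show "Suc ` S_word w \<subseteq> S_word (LC # w)"
    using S_word_append[of "LC # _"] by (auto elim!: S_word_cases)
qed

lemma S_word_D: "S_word (LD # w) = insert 2 ((\<lambda>s. Suc (Suc s)) ` S_word w)"
proof
  show "S_word (LD # w) \<subseteq> insert 2 ((\<lambda>s. Suc (Suc s)) ` S_word w)"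
    by (auto elim!: S_word_cases simp: Cons_eq_append_conv intro!: imageI S_word_append)
  show "insert 2 ((\<lambda>s. Suc (Suc s)) ` S_word w) \<subseteq> S_word (LD # w)"
    using S_word_append[of "LD # _"] S_word_append[of "[]" w] by (auto elim!: S_word_cases simp: numeral_2_eq_2)
qed

lemma card_Int_greaterThanAtMost_Suc:
  "card (T \<inter> {k<..k + Suc d}) = of_bool (Suc k \<in> T) + card (T \<inter> {Suc k<..Suc k + d})"
  unfolding greaterThanAtMost_Suc by (simp add: Int_insert_right)

text \<open>
  Multiplying out \<open>w\<close> gives \<open>\<^bold>a\<^bold>b\<close>-words with coefficient \<open>1\<close>, in which a letter \<open>\<^bold>c\<close> leaves its
  position free and a letter \<open>\<^bold>d\<close> puts exactly one \<open>\<^bold>b\<close> on its two positions. If \<open>\<^bold>b\<close> may only be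
  placed on \<open>T\<close>, a \<open>\<^bold>c\<close> has \<open>2\<close> choices or \<open>1\<close>, according to whether its position is in \<open>T\<close>, and a
  \<open>\<^bold>d\<close> has as many choices as \<open>T\<close> has elements among its two positions \<open>i - 1, i\<close>, that is
  \<open>0\<close>, \<open>2\<^sup>1 / 2\<close> or \<open>2\<^sup>2 / 2\<close>. No choice is possible iff \<open>i\<close>, an element of \<open>S_word w\<close>, is neither in
  \<open>T\<close> nor in \<open>Suc ` T\<close>.
\<close>

lemma sum_coeff_cd_monomial:
  "2 ^ count_list w LD *
     (\<Sum>S \<in> Pow (T \<inter> {k<..k + cd_degree w}). coeff (cd_monomial w) (ab_word k (cd_degree w) S)) =
   (if (+) k ` S_word w \<subseteq> T \<union> Suc ` T then 2 ^ card (T \<inter> {k<..k + cd_degree w}) else 0)"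
  (is "2 ^ count_list w LD * ?sum w k = (if ?hit w k then 2 ^ ?card w k else 0)")
proof (induction w arbitrary: k)
  case Nil
  then show ?case by (simp add: S_word_Nil ab_word_0 lookup_one zero_list_def)
next
  case (Cons x w)
  show ?case
  proof (cases x)
    case LC
    let ?k = "Suc k" and ?b = "Suc k \<in> T"
    have hit: "?hit (LC # w) k \<longleftrightarrow> ?hit w ?k"
      by (simp add: S_word_C image_image)
    have sum: "?sum (LC # w) k = (1 + of_bool ?b) * ?sum w ?k"
      unfolding cd_degree_simps list.map prod_list.Cons sum_Pow_ab_word coeff_c_mult by simp
    have card: "?card (LC # w) k = of_bool ?b + ?card w ?k"
      unfolding cd_degree_simps by (rule card_Int_greaterThanAtMost_Suc)
    have "2 ^ count_list (LC # w) LD * ?sum (LC # w) k =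
        (1 + of_bool ?b) * (2 ^ count_list w LD * ?sum w ?k)"
      unfolding sum by simp
    also have "\<dots> = (if ?hit (LC # w) k then 2 ^ ?card (LC # w) k else 0)"
      unfolding Cons.IH hit card by (cases ?b) (simp_all only: of_bool_eq, simp_all)
    finally show ?thesis unfolding LC .
  next
    case LD
    let ?k = "Suc (Suc k)" and ?b = "Suc k \<in> T" and ?b' = "Suc (Suc k) \<in> T"
    have hit: "?hit (LD # w) k \<longleftrightarrow> (?b \<or> ?b') \<and> ?hit w ?k"
      by (auto simp: S_word_D image_image)
    have sum: "?sum (LD # w) k = (of_bool ?b + of_bool ?b') * ?sum w ?k"
      unfolding cd_degree_simps list.map prod_list.Cons sum_Pow_ab_word
        sum_Pow_ab_word[where g = "\<lambda>v. coeff (cd_to_ab LD * cd_monomial w) (LA # v)"]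
        sum_Pow_ab_word[where g = "\<lambda>v. coeff (cd_to_ab LD * cd_monomial w) (LB # v)"]
        coeff_d_mult by simp
    have card: "?card (LD # w) k = of_bool ?b + (of_bool ?b' + ?card w ?k)"
      unfolding cd_degree_simps card_Int_greaterThanAtMost_Suc ..
    have "2 ^ count_list (LD # w) LD * ?sum (LD # w) k =
        2 * (of_bool ?b + of_bool ?b') * (2 ^ count_list w LD * ?sum w ?k)"
      unfolding sum by simp
    also have "\<dots> = (if ?hit (LD # w) k then 2 ^ ?card (LD # w) k else 0)"
      unfolding Cons.IH hit card by (cases ?b; cases ?b') (simp_all only: of_bool_eq, simp_all)
    finally show ?thesis unfolding LD .
  qed
qed

section \<open>The quasisymmetric function\<close>

text \<open>
  The flag number \<open>f\<^sub>T\<close> is the sum of the coefficients of the \<open>\<^bold>a\<^bold>b\<close>-index at the words \<open>u\<^sub>S\<close> with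
  \<open>S \<subseteq> T\<close>, and \<open>sum_coeff_cd_monomial\<close> evaluates that sum for each \<open>\<^bold>c\<^bold>d\<close>-monomial.
\<close>

lemma flag_f_eq_sum_cd_index:
  assumes "eulerian P" "poset_rank P = Suc n" "T \<subseteq> {1..n}"
  shows "(of_nat (flag_f P T) :: rat) = (\<Sum>w | cd_degree w = n.
    of_int (Poly_Mapping.lookup (cd_index P) w) *
    (if S_word w \<subseteq> T \<union> Suc ` T then 2 ^ card T / 2 ^ count_list w LD else 0))"
proof -
  let ?c = "Poly_Mapping.lookup (cd_index P)"
  have h: "flag_h P S = coeff (cd_combination n ?c) (ab_word 0 n S)" if "S \<in> Pow T" for S
    using that assms(3) coeff_sum_u_monomial[of S n "flag_h P"]
    by (simp add: cd_combination_cd_index[OF assms(1,2)])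
  let ?s = "\<lambda>w. \<Sum>S \<in> Pow T. coeff (cd_monomial w) (ab_word 0 n S)"
  have s: "of_int (?s w) = (if S_word w \<subseteq> T \<union> Suc ` T then 2 ^ card T / 2 ^ count_list w LD else (0 :: rat))"
    if "cd_degree w = n" for w
  proof -
    have "T \<inter> {0<..n} = T" using assms(3) by auto
    then have "2 ^ count_list w LD * ?s w = (if S_word w \<subseteq> T \<union> Suc ` T then 2 ^ card T else 0)"
      using sum_coeff_cd_monomial[where k = 0 and w = w and T = T] that by simp
    from arg_cong[OF this, of "of_int :: int \<Rightarrow> rat"] show ?thesis
      by (simp add: field_simps split: if_splits)
  qed
  have "int (flag_f P T) = (\<Sum>S \<in> Pow T. flag_h P S)"
    using assms(3) flag_f_eq_sum_flag_h finite_subset by blast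
  also have "\<dots> = (\<Sum>S \<in> Pow T. \<Sum>w | cd_degree w = n. ?c w * coeff (cd_monomial w) (ab_word 0 n S))"
    by (rule sum.cong) (simp_all add: h cd_combination_def lookup_sum coeff_of_int_mult)
  also have "\<dots> = (\<Sum>w | cd_degree w = n. ?c w * ?s w)"
    by (subst sum.swap) (simp add: sum_distrib_left)
  finally have "(of_int (int (flag_f P T)) :: rat) = (\<Sum>w | cd_degree w = n. of_int (?c w) * of_int (?s w))"
    by (simp only: of_int_sum of_int_mult)
  also have "\<dots> = (\<Sum>w | cd_degree w = n. of_int (?c w) *
      (if S_word w \<subseteq> T \<union> Suc ` T then 2 ^ card T / 2 ^ count_list w LD else 0))"
    by (rule sum.cong) (simp_all only: s mem_Collect_eq)
  finally show ?thesis by simp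
qed

theorem corollary2p2:
  fixes P :: "'a rel" and n :: nat
  assumes "eulerian P" and "poset_rank P = n + 1"
  shows "F_quasi P =
    (\<lambda>m. \<Sum>w | cd_degree w = n.
      1 / 2 ^ (count_list w LD + 1) * of_int (Poly_Mapping.lookup (cd_index P) w) * Theta w m)"
proof
  fix m
  let ?c = "\<lambda>w. (of_int (Poly_Mapping.lookup (cd_index P) w) :: rat)"
  let ?M = "\<lambda>T. M_set (n + 1) T m"
  let ?v = "\<lambda>w T. (if S_word w \<subseteq> T \<union> Suc ` T then 2 ^ card T / 2 ^ count_list w LD else (0 :: rat))"
  have Theta: "1 / 2 ^ (count_list w LD + 1) * ?c w * Theta w m =
      (\<Sum>T \<in> Pow {1..n}. ?c w * ?v w T * ?M T)" if "cd_degree w = n" for w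
  proof -
    have "{T. T \<subseteq> {1..n} \<and> S_word w \<subseteq> T \<union> Suc ` T} = {T \<in> Pow {1..n}. S_word w \<subseteq> T \<union> Suc ` T}"
      by auto
    then have "Theta w m = (\<Sum>T \<in> Pow {1..n}.
        if S_word w \<subseteq> T \<union> Suc ` T then 2 ^ (card T + 1) * ?M T else 0)"
      unfolding Theta_def Let_def that by (simp only: sum.inter_filter finite_Pow_iff finite_atLeastAtMost)
    then show ?thesis
      unfolding sum_distrib_left by (auto intro!: sum.cong simp: sum_distrib_left)
  qed
  have "F_quasi P m = (\<Sum>T \<in> Pow {1..n}. \<Sum>w | cd_degree w = n. ?c w * ?v w T * ?M T)"
    unfolding F_quasi_def
    using flag_f_eq_sum_cd_index[OF assms(1)] assms(2)
    by (auto intro!: sum.cong simp: sum_distrib_right)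
  also have "\<dots> = (\<Sum>w | cd_degree w = n. 1 / 2 ^ (count_list w LD + 1) * ?c w * Theta w m)"
    by (subst sum.swap) (rule sum.cong, simp_all only: Theta mem_Collect_eq)
  finally show "F_quasi P m = (\<Sum>w | cd_degree w = n.
      1 / 2 ^ (count_list w LD + 1) * ?c w * Theta w m)" .
qed

end
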